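(* Let $\alpha_0,\dots,\alpha_6$ be complex parameters with $\alpha_0+\alpha_1+2\alpha_2+2\alpha_3+2\alpha_4+\alpha_5+\alpha_6=1$, and consider the Hamiltonian system $$\frac{dx}{dt}=\frac{\partial H}{\partial y},\ \frac{dy}{dt}=-\frac{\partial H}{\partial x},\ \frac{dz}{dt}=\frac{\partial H}{\partial w},\ \frac{dw}{dt}=-\frac{\partial H}{\partial z},\ \frac{dq}{dt}=\frac{\partial H}{\partial p},\ \frac{dp}{dt}=-\frac{\partial H}{\partial q}$$ with $$\begin{aligned} tH={}&x^2(y-1)y+x\{(\alpha_0+\alpha_1)y-\alpha_1\}+ty+z^2(w-1)w+z\{(\alpha_0+\alpha_1+2\alpha_2+2\alpha_3)w-\alpha_3\}+tw\\&+q^2(p-t)p+q\{(\alpha_5+\alpha_6-1)p-t\alpha_5\}+p+2yz(zw+\alpha_3)-2(y+w)p.\end{aligned}$$ For $\varepsilon\ne0$ make the change of parameters and variables $$\alpha_0=\frac1\varepsilon+A_0,\ \alpha_1=-\frac1\varepsilon,\ \alpha_2=\frac{A_1}{2},\ \alpha_3=\frac{A_2}{2},\ \alpha_4=\frac{A_3}{2},\ \alpha_5=\frac1\varepsilon,\ \alpha_6=-\frac1\varepsilon+A_4,$$ $$t=\frac{\varepsilon^2}{16}T,\ x=\frac{\varepsilon}{4}X,\ y=\frac{2Y}{\varepsilon},\ z=\frac{\varepsilon}{4}Z,\ w=\frac{2W}{\varepsilon},\ q=\frac{4Q}{\varepsilon},\ p=\frac{\varepsilon}{8}P$$ from $\alpha_0,\dots,\alpha_6,t,x,y,z,w,q,p$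 to $A_0,\dots,A_4,T,X,Y,Z,W,Q,P$. Then the system can also be written in the new variables $X,Y,Z,W,Q,P$ (with independent variable $T$) and parameters $A_0,\dots,A_4$ as a Hamiltonian system, and this new system tends, as $\varepsilon\to0$, to the Hamiltonian system (in the canonical pairs $(X,Y),(Z,W),(Q,P)$ and independent variable $T$) with Hamiltonian $$\begin{aligned}&\frac{X^2Y^2+2A_0XY+X}{2T}+\frac{Z^2W^2+2(A_0+A_1+A_2)ZW}{2T}+\frac{Q^2P^2+2(A_4-1)QP-TQ}{2T}\\&+\frac{YZ(ZW+A_2)}{T}-\frac{(Y+W)P}{T},\end{aligned}$$ where $A_0+A_1+A_2+A_3+A_4=1$.
   Context: A Hamiltonian system with Hamiltonian $K$ in canonical pairs $(X,Y),(Z,W),(Q,P)$ and time $T$ means $\frac{dX}{dT}=\frac{\partial K}{\partial Y},\ \frac{dY}{dT}=-\frac{\partial K}{\partial X}$, and similarly for $(Z,W)$ and $(Q,P)$. "Tends to" means that the right-hand sides of the differential equations converge as $\varepsilon\to0$ with $X,Y,Z,W,Q,P,T,A_i$ fixed. *)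

theory Defs
  imports "HOL-Complex_Analysis.Complex_Analysis"
begin

text \<open>
  A Hamiltonian is a function \<open>K t x y z w q p\<close> of a complex time and of three canonical
  pairs \<open>(x, y)\<close>, \<open>(z, w)\<close>, \<open>(q, p)\<close>.
\<close>

type_synonym hamiltonian =
  "complex \<Rightarrow> complex \<Rightarrow> complex \<Rightarrow> complex \<Rightarrow> complex \<Rightarrow> complex \<Rightarrow> complex \<Rightarrow> complex"

text \<open>
  Holomorphy on \<open>t \<noteq> 0\<close> is required in each variable separately (equivalent to joint
  holomorphy, by Hartogs). It guarantees that the partial derivatives in \<open>ham_rhs\<close> exist,
  so that \<open>deriv\<close> never takes an unspecified value.
\<close>

definition holomorphic_hamiltonian :: "hamiltonian \<Rightarrow> bool" where
  "holomorphic_hamiltonian K \<longleftrightarrow>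
    (\<forall>x y z w q p. (\<lambda>t. K t x y z w q p) holomorphic_on - {0}) \<and>
    (\<forall>t x y z w q p. t \<noteq> 0 \<longrightarrow>
      (\<lambda>u. K t u y z w q p) holomorphic_on UNIV \<and>
      (\<lambda>u. K t x u z w q p) holomorphic_on UNIV \<and>
      (\<lambda>u. K t x y u w q p) holomorphic_on UNIV \<and>
      (\<lambda>u. K t x y z u q p) holomorphic_on UNIV \<and>
      (\<lambda>u. K t x y z w u p) holomorphic_on UNIV \<and>
      (\<lambda>u. K t x y z w q u) holomorphic_on UNIV)"

definition ham_rhs ::
  "hamiltonian \<Rightarrow> complex \<Rightarrow> complex \<Rightarrow> complex \<Rightarrow> complex \<Rightarrow> complex \<Rightarrow> complex \<Rightarrow> complex \<Rightarrow>
    complex \<times> complex \<times> complex \<times> complex \<times> complex \<times> complex" where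
  "ham_rhs K t x y z w q p =
    (deriv (\<lambda>u. K t x u z w q p) y, - deriv (\<lambda>u. K t u y z w q p) x,
     deriv (\<lambda>u. K t x y z u q p) w, - deriv (\<lambda>u. K t x y u w q p) z,
     deriv (\<lambda>u. K t x y z w q u) p, - deriv (\<lambda>u. K t x y z w u p) q)"

definition ham_solution ::
  "hamiltonian \<Rightarrow> complex set \<Rightarrow> (complex \<Rightarrow> complex) \<Rightarrow> (complex \<Rightarrow> complex) \<Rightarrow>
    (complex \<Rightarrow> complex) \<Rightarrow> (complex \<Rightarrow> complex) \<Rightarrow> (complex \<Rightarrow> complex) \<Rightarrow>
    (complex \<Rightarrow> complex) \<Rightarrow> bool" where
  "ham_solution K D x y z w q p \<longleftrightarrow>
    (\<forall>t\<in>D. case ham_rhs K t (x t) (y t) (z t) (w t) (q t) (p t) of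
      (dx, dy, dz, dw, dq, dp) \<Rightarrow>
        (x has_field_derivative dx) (at t) \<and> (y has_field_derivative dy) (at t) \<and>
        (z has_field_derivative dz) (at t) \<and> (w has_field_derivative dw) (at t) \<and>
        (q has_field_derivative dq) (at t) \<and> (p has_field_derivative dp) (at t))"

text \<open>Only the values \<open>\<alpha> 0, \<dots>, \<alpha> 6\<close> and \<open>A 0, \<dots>, A 4\<close> of the parameter functions below are used.\<close>

definition ham_H :: "(nat \<Rightarrow> complex) \<Rightarrow> hamiltonian" where
  "ham_H \<alpha> t x y z w q p =
    (x^2 * (y - 1) * y + x * ((\<alpha> 0 + \<alpha> 1) * y - \<alpha> 1) + t * y
     + z^2 * (w - 1) * w + z * ((\<alpha> 0 + \<alpha> 1 + 2 * \<alpha> 2 + 2 * \<alpha> 3) * w - \<alpha> 3) + t * w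
     + q^2 * (p - t) * p + q * ((\<alpha> 5 + \<alpha> 6 - 1) * p - t * \<alpha> 5) + p
     + 2 * y * z * (z * w + \<alpha> 3) - 2 * (y + w) * p) / t"

definition ham_limit :: "(nat \<Rightarrow> complex) \<Rightarrow> hamiltonian" where
  "ham_limit A T X Y Z W Q P =
    (X^2 * Y^2 + 2 * A 0 * X * Y + X) / (2 * T)
    + (Z^2 * W^2 + 2 * (A 0 + A 1 + A 2) * Z * W) / (2 * T)
    + (Q^2 * P^2 + 2 * (A 4 - 1) * Q * P - T * Q) / (2 * T)
    + Y * Z * (Z * W + A 2) / T - (Y + W) * P / T"

definition alpha_of :: "complex \<Rightarrow> (nat \<Rightarrow> complex) \<Rightarrow> nat \<Rightarrow> complex" where
  "alpha_of \<epsilon> A i =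
    [1 / \<epsilon> + A 0, - 1 / \<epsilon>, A 1 / 2, A 2 / 2, A 3 / 2, 1 / \<epsilon>, - 1 / \<epsilon> + A 4] ! i"

end

theory Submission
  imports Defs
begin

text \<open>
  Two facts carry the proof.

  First, in each canonical pair the scale factors of the two variables have product \<open>1/2\<close>, the
  same for all three pairs. A scaling that multiplies every \<open>dx \<and> dy\<close> by a common constant
  \<open>1/\<kappa>\<close>, together with a time change \<open>t = c T\<close>, turns a Hamiltonian system into the Hamiltonian
  system of \<open>\<kappa> c H\<close> expressed in the new variables. Here \<open>\<kappa> = 2\<close> and \<open>c = \<epsilon>\<^sup>2/16\<close>
  (lemma \<open>ham_solution_rescale\<close>).

  Second, the parameters are chosen so that every negative power of \<open>\<epsilon>\<close> cancels: the new
  Hamiltonian is \<^emph>\<open>exactly\<close> the limit Hamiltonian plus \<open>\<epsilon>\<close> times a Hamiltonian that does not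
  depend on \<open>\<epsilon>\<close> (lemma \<open>rescaled_ham_H_expansion\<close>). The right-hand sides depend linearly on the
  Hamiltonian, so they converge as \<open>\<epsilon> \<rightarrow> 0\<close> (lemma \<open>tendsto_ham_rhs_perturbation\<close>).
\<close>

section \<open>Hamiltonian systems under scaling of variables and time\<close>

definition rescale ::
  "complex \<Rightarrow> complex \<Rightarrow> complex \<Rightarrow> complex \<Rightarrow> complex \<Rightarrow> complex \<Rightarrow> complex \<Rightarrow> complex \<Rightarrow>
    hamiltonian \<Rightarrow> hamiltonian" where
  "rescale \<kappa> c a b d e f g H T X Y Z W Q P =
    \<kappa> * c * H (c * T) (a * X) (b * Y) (d * Z) (e * W) (f * Q) (g * P)"

lemma holomorphic_on_scaled:
  assumes "F holomorphic_on B" "(\<lambda>u. a * u) ` S \<subseteq> B"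
  shows "(\<lambda>u. k * F (a * u)) holomorphic_on S"
  using holomorphic_on_compose_gen[OF _ assms(1), of "\<lambda>u. a * u" S] assms(2)
  by (auto intro!: holomorphic_intros simp: o_def)

lemma deriv_scaled:
  assumes "F holomorphic_on UNIV"
  shows "deriv (\<lambda>u. k * F (a * u)) x = k * a * deriv F (a * x)"
proof -
  have "(F has_field_derivative deriv F (a * x)) (at (a * x))"
    using assms by (intro holomorphic_derivI[of _ UNIV]) auto
  then have "((\<lambda>u. F (a * u)) has_field_derivative deriv F (a * x) * a) (at x)"
    by (rule DERIV_chain'[rotated]) (auto intro!: derivative_eq_intros)
  then show ?thesis
    by (intro DERIV_imp_deriv) (auto intro!: derivative_eq_intros)
qed

text \<open>
  The functions \<open>x\<close> and \<open>X\<close> determine each other only on \<open>c D\<close> and \<open>D\<close>. That is enough for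
  derivatives because both sets are open, which needs \<open>c \<noteq> 0\<close>.
\<close>

lemma has_field_derivative_rescale_iff:
  fixes x X :: "complex \<Rightarrow> complex"
  assumes D: "open D" "T \<in> D" and c: "c \<noteq> 0" and k: "k \<noteq> 0"
    and eq: "\<And>S. S \<in> D \<Longrightarrow> x (c * S) = k * X S"
  shows "(x has_field_derivative l) (at (c * T)) \<longleftrightarrow>
         (X has_field_derivative c * l / k) (at T)"
proof
  assume "(x has_field_derivative l) (at (c * T))"
  then have "((\<lambda>S. x (c * S)) has_field_derivative l * c) (at T)"
    by (rule DERIV_chain'[rotated]) (auto intro!: derivative_eq_intros)
  then have "((\<lambda>S. x (c * S) / k) has_field_derivative c * l / k) (at T)"
    using DERIV_cdivide[of "\<lambda>S. x (c * S)" "l * c" T UNIV k] by (simp add: mult.commute)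
  then show "(X has_field_derivative c * l / k) (at T)"
    by (rule has_field_derivative_transform_within_open[OF _ D]) (use eq k in auto)
next
  assume X: "(X has_field_derivative c * l / k) (at T)"
  have "((\<lambda>s. X (s / c)) has_field_derivative (c * l / k) * (1 / c)) (at (c * T))"
    by (rule DERIV_chain'[where g = X])
       (use X c in \<open>auto intro!: derivative_eq_intros\<close>)
  then have deriv: "((\<lambda>s. k * X (s / c)) has_field_derivative l) (at (c * T))"
    using c k by (auto intro!: derivative_eq_intros)
  show "(x has_field_derivative l) (at (c * T))"
  proof (rule has_field_derivative_transform_within_open[OF deriv])
    show "open ((\<lambda>S. c * S) ` D)"
      by (rule open_times_image[OF c D(1)])
  qed (use D c eq in auto)
qed

lemma holomorphic_hamiltonianD:
  assumes "holomorphic_hamiltonian K" "t \<noteq> 0"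
  shows "(\<lambda>u. K t u y z w q p) holomorphic_on UNIV"
    "(\<lambda>u. K t x u z w q p) holomorphic_on UNIV"
    "(\<lambda>u. K t x y u w q p) holomorphic_on UNIV"
    "(\<lambda>u. K t x y z u q p) holomorphic_on UNIV"
    "(\<lambda>u. K t x y z w u p) holomorphic_on UNIV"
    "(\<lambda>u. K t x y z w q u) holomorphic_on UNIV"
  using assms unfolding holomorphic_hamiltonian_def by blast+

lemma holomorphic_hamiltonian_rescale:
  assumes H: "holomorphic_hamiltonian H" and c: "c \<noteq> 0"
  shows "holomorphic_hamiltonian (rescale \<kappa> c a b d e f g H)"
  unfolding holomorphic_hamiltonian_def
proof (intro conjI allI impI)
  fix X Y Z W Q P :: complex
  note hol = H[unfolded holomorphic_hamiltonian_def, THEN conjunct1, rule_format]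
  show "(\<lambda>t. rescale \<kappa> c a b d e f g H t X Y Z W Q P) holomorphic_on - {0}"
    unfolding rescale_def by (rule holomorphic_on_scaled[OF hol]) (use c in auto)
next
  fix T X Y Z W Q P :: complex assume "T \<noteq> 0"
  then have "c * T \<noteq> 0" using c by simp
  note hol = holomorphic_hamiltonianD[OF H this]
  show "(\<lambda>u. rescale \<kappa> c a b d e f g H T u Y Z W Q P) holomorphic_on UNIV"
    "(\<lambda>u. rescale \<kappa> c a b d e f g H T X u Z W Q P) holomorphic_on UNIV"
    "(\<lambda>u. rescale \<kappa> c a b d e f g H T X Y u W Q P) holomorphic_on UNIV"
    "(\<lambda>u. rescale \<kappa> c a b d e f g H T X Y Z u Q P) holomorphic_on UNIV"
    "(\<lambda>u. rescale \<kappa> c a b d e f g H T X Y Z W u P) holomorphic_on UNIV"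
    "(\<lambda>u. rescale \<kappa> c a b d e f g H T X Y Z W Q u) holomorphic_on UNIV"
    unfolding rescale_def
    by (rule holomorphic_on_scaled[where B = UNIV], simp add: hol, simp)+
qed

lemma ham_rhs_rescale:
  assumes H: "holomorphic_hamiltonian H" and nz: "c \<noteq> 0" "T \<noteq> 0"
    and rhs: "ham_rhs H (c * T) (a * X) (b * Y) (d * Z) (e * W) (f * Q) (g * P) =
                (dx, dy, dz, dw, dq, dp)"
  shows "ham_rhs (rescale \<kappa> c a b d e f g H) T X Y Z W Q P =
    (\<kappa> * c * b * dx, \<kappa> * c * a * dy, \<kappa> * c * e * dz, \<kappa> * c * d * dw,
     \<kappa> * c * g * dq, \<kappa> * c * f * dp)"
proof -
  have "c * T \<noteq> 0" using nz by simp
  note hol = holomorphic_hamiltonianD[OF H this]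
  show ?thesis
    using rhs unfolding ham_rhs_def rescale_def
    by (auto simp: hol[THEN deriv_scaled])
qed

text \<open>
  From \<open>x' = \<partial>H/\<partial>y\<close> and \<open>x = a X\<close> one gets \<open>X' = (c / a) \<partial>H/\<partial>y\<close>, while differentiating the
  rescaled Hamiltonian by \<open>Y\<close> gives \<open>\<kappa> c b \<partial>H/\<partial>y\<close>; the two agree because \<open>\<kappa> a b = 1\<close>. A single
  Hamiltonian governs all three pairs, so one constant \<open>\<kappa>\<close> has to serve all of them.
\<close>

lemma ham_solution_rescale:
  assumes H: "holomorphic_hamiltonian H" and c: "c \<noteq> 0"
    and symp: "\<kappa> * a * b = 1" "\<kappa> * d * e = 1" "\<kappa> * f * g = 1"
    and D: "open D" "0 \<notin> D"
    and sub: "\<And>T. T \<in> D \<Longrightarrow> x (c * T) = a * X T" "\<And>T. T \<in> D \<Longrightarrow> y (c * T) = b * Y T"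
      "\<And>T. T \<in> D \<Longrightarrow> z (c * T) = d * Z T" "\<And>T. T \<in> D \<Longrightarrow> w (c * T) = e * W T"
      "\<And>T. T \<in> D \<Longrightarrow> q (c * T) = f * Q T" "\<And>T. T \<in> D \<Longrightarrow> p (c * T) = g * P T"
  shows "ham_solution H ((\<lambda>T. c * T) ` D) x y z w q p \<longleftrightarrow>
         ham_solution (rescale \<kappa> c a b d e f g H) D X Y Z W Q P"
proof -
  have nz: "a \<noteq> 0" "b \<noteq> 0" "d \<noteq> 0" "e \<noteq> 0" "f \<noteq> 0" "g \<noteq> 0"
    using symp by auto
  have quot: "c * l / a = \<kappa> * c * b * l" "c * l / b = \<kappa> * c * a * l"
    "c * l / d = \<kappa> * c * e * l" "c * l / e = \<kappa> * c * d * l"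
    "c * l / f = \<kappa> * c * g * l" "c * l / g = \<kappa> * c * f * l" for l
    using symp nz by (simp_all add: divide_eq_eq ac_simps)
  have pointwise:
    "(case ham_rhs H (c * T) (x (c * T)) (y (c * T)) (z (c * T)) (w (c * T)) (q (c * T)) (p (c * T)) of
       (dx, dy, dz, dw, dq, dp) \<Rightarrow>
        (x has_field_derivative dx) (at (c * T)) \<and> (y has_field_derivative dy) (at (c * T)) \<and>
        (z has_field_derivative dz) (at (c * T)) \<and> (w has_field_derivative dw) (at (c * T)) \<and>
        (q has_field_derivative dq) (at (c * T)) \<and> (p has_field_derivative dp) (at (c * T))) \<longleftrightarrow>
     (case ham_rhs (rescale \<kappa> c a b d e f g H) T (X T) (Y T) (Z T) (W T) (Q T) (P T) of
       (dx, dy, dz, dw, dq, dp) \<Rightarrow>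
        (X has_field_derivative dx) (at T) \<and> (Y has_field_derivative dy) (at T) \<and>
        (Z has_field_derivative dz) (at T) \<and> (W has_field_derivative dw) (at T) \<and>
        (Q has_field_derivative dq) (at T) \<and> (P has_field_derivative dp) (at T))"
    if T: "T \<in> D" for T
  proof -
    obtain dx dy dz dw dq dp where rhs:
      "ham_rhs H (c * T) (a * X T) (b * Y T) (d * Z T) (e * W T) (f * Q T) (g * P T) =
        (dx, dy, dz, dw, dq, dp)"
      by (metis prod_cases6)
    have "T \<noteq> 0" using T D by auto
    note rhs' = ham_rhs_rescale[OF H c this rhs, of \<kappa>]
    note iff = has_field_derivative_rescale_iff[OF D(1) T c]
    show ?thesis
      unfolding sub[OF T] rhs rhs' prod.case
      by (simp only: iff[of a x X, OF nz(1) sub(1)] iff[of b y Y, OF nz(2) sub(2)]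
          iff[of d z Z, OF nz(3) sub(3)] iff[of e w W, OF nz(4) sub(4)]
          iff[of f q Q, OF nz(5) sub(5)] iff[of g p P, OF nz(6) sub(6)] quot)
  qed
  show ?thesis
    unfolding ham_solution_def ball_simps by (intro ball_cong refl pointwise)
qed

section \<open>Dependence of the right-hand sides on a perturbation\<close>

lemma deriv_perturbed:
  assumes "F holomorphic_on UNIV" "G holomorphic_on UNIV"
  shows "deriv (\<lambda>u. F u + k * G u) x = deriv F x + k * deriv G x"
proof -
  have "(F has_field_derivative deriv F x) (at x)" "(G has_field_derivative deriv G x) (at x)"
    using assms by (auto intro!: holomorphic_derivI[of _ UNIV])
  then show ?thesis
    by (intro DERIV_imp_deriv) (auto intro!: derivative_eq_intros)
qed

lemma tendsto_ham_rhs_perturbation: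
  assumes K: "holomorphic_hamiltonian K" and R: "holomorphic_hamiltonian R" and T: "T \<noteq> 0"
  shows "((\<lambda>\<epsilon>. ham_rhs (\<lambda>t x y z w q p. K t x y z w q p + \<epsilon> * R t x y z w q p) T X Y Z W Q P)
           \<longlongrightarrow> ham_rhs K T X Y Z W Q P) (at 0)"
proof -
  note holK = holomorphic_hamiltonianD[OF K T]
  note holR = holomorphic_hamiltonianD[OF R T]
  have lim: "((\<lambda>\<epsilon>. k + \<epsilon> * r) \<longlongrightarrow> k) (at 0)" for k r :: complex
    by (auto intro!: tendsto_eq_intros)
  have lim_minus: "((\<lambda>\<epsilon>. - (k + \<epsilon> * r)) \<longlongrightarrow> - k) (at 0)" for k r :: complex
    by (intro tendsto_minus lim)
  show ?thesis
    unfolding ham_rhs_def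
    by (simp only: deriv_perturbed holK holR) (intro tendsto_Pair lim lim_minus)
qed

section \<open>The coupled system and its limit\<close>

lemma holomorphic_hamiltonian_ham_H: "holomorphic_hamiltonian (ham_H \<alpha>)"
  unfolding holomorphic_hamiltonian_def ham_H_def by (auto intro!: holomorphic_intros)

lemma holomorphic_hamiltonian_ham_limit: "holomorphic_hamiltonian (ham_limit A)"
  unfolding holomorphic_hamiltonian_def ham_limit_def by (auto intro!: holomorphic_intros)

text \<open>The coefficient of \<open>\<epsilon>\<close> in the rescaled Hamiltonian, see \<open>rescaled_ham_H_expansion\<close>.\<close>

definition ham_correction :: "(nat \<Rightarrow> complex) \<Rightarrow> hamiltonian" where
  "ham_correction A T X Y Z W Q P =
    (T * Y + T * W + P - X^2 * Y - Z^2 * W - A 2 * Z - T * Q^2 * P) / (4 * T)"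

lemma holomorphic_hamiltonian_ham_correction: "holomorphic_hamiltonian (ham_correction A)"
  unfolding holomorphic_hamiltonian_def ham_correction_def by (auto intro!: holomorphic_intros)

definition rescaled_ham_H :: "(nat \<Rightarrow> complex) \<Rightarrow> complex \<Rightarrow> hamiltonian" where
  "rescaled_ham_H A \<epsilon> =
    rescale 2 (\<epsilon>^2 / 16) (\<epsilon> / 4) (2 / \<epsilon>) (\<epsilon> / 4) (2 / \<epsilon>) (4 / \<epsilon>) (\<epsilon> / 8) (ham_H (alpha_of \<epsilon> A))"

text \<open>
  The variables \<open>y\<close>, \<open>w\<close>, \<open>q\<close> are of order \<open>1/\<epsilon>\<close>, but in every monomial of \<open>t H\<close> they are
  balanced by at least as many factors among \<open>x\<close>, \<open>z\<close>, \<open>p\<close> (of order \<open>\<epsilon>\<close>) and \<open>t\<close> (of order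
  \<open>\<epsilon>\<^sup>2\<close>). As for the parameters, \<open>\<alpha>\<^sub>0 + \<alpha>\<^sub>1\<close> and \<open>\<alpha>\<^sub>5 + \<alpha>\<^sub>6\<close> are free of \<open>1/\<epsilon>\<close>, and apart from
  these sums \<open>\<alpha>\<^sub>1\<close> and \<open>\<alpha>\<^sub>5\<close> occur only in \<open>- x \<alpha>\<^sub>1\<close> and \<open>- q t \<alpha>\<^sub>5\<close>, where \<open>x\<close> and \<open>q t\<close> are of
  order \<open>\<epsilon>\<close>. These two products supply the terms \<open>X\<close> and \<open>- T Q\<close> of the limit.
\<close>

lemma rescaled_ham_H_expansion:
  assumes "\<epsilon> \<noteq> 0" "T \<noteq> 0"
  shows "rescaled_ham_H A \<epsilon> T X Y Z W Q P =
    ham_limit A T X Y Z W Q P + \<epsilon> * ham_correction A T X Y Z W Q P"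
  using assms
  unfolding rescaled_ham_H_def rescale_def ham_H_def ham_limit_def ham_correction_def alpha_of_def
  by (simp add: divide_simps) (simp add: algebra_simps power2_eq_square)

lemma tendsto_ham_rhs_rescaled_ham_H:
  assumes T: "T \<noteq> 0"
  shows "((\<lambda>\<epsilon>. ham_rhs (rescaled_ham_H A \<epsilon>) T X Y Z W Q P)
           \<longlongrightarrow> ham_rhs (ham_limit A) T X Y Z W Q P) (at 0)"
proof (rule Lim_transform_eventually)
  show "((\<lambda>\<epsilon>. ham_rhs (\<lambda>t x y z w q p. ham_limit A t x y z w q p
                 + \<epsilon> * ham_correction A t x y z w q p) T X Y Z W Q P)
           \<longlongrightarrow> ham_rhs (ham_limit A) T X Y Z W Q P) (at 0)"
    by (intro tendsto_ham_rhs_perturbation holomorphic_hamiltonian_ham_limit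
        holomorphic_hamiltonian_ham_correction T)
  \<comment> \<open>The expansion is available only for \<open>\<epsilon> \<noteq> 0\<close> and \<open>T \<noteq> 0\<close>. This suffices: the limit ignores
     \<open>\<epsilon> = 0\<close>, and the right-hand side at time \<open>T\<close> involves the Hamiltonian at that time alone.\<close>
  show "\<forall>\<^sub>F \<epsilon> in at 0.
          ham_rhs (\<lambda>t x y z w q p. ham_limit A t x y z w q p
                 + \<epsilon> * ham_correction A t x y z w q p) T X Y Z W Q P =
          ham_rhs (rescaled_ham_H A \<epsilon>) T X Y Z W Q P"
    using eventually_neq_at_within[of 0]
    by eventually_elim (simp add: ham_rhs_def rescaled_ham_H_expansion T)
qed

lemma alpha_of_normalization_iff:
  "alpha_of \<epsilon> A 0 + alpha_of \<epsilon> A 1 + 2 * alpha_of \<epsilon> A 2 + 2 * alpha_of \<epsilon> A 3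
     + 2 * alpha_of \<epsilon> A 4 + alpha_of \<epsilon> A 5 + alpha_of \<epsilon> A 6 = 1
   \<longleftrightarrow> A 0 + A 1 + A 2 + A 3 + A 4 = 1"
  by (simp add: alpha_of_def add.assoc)

theorem theorem4p8:
  fixes A :: "nat \<Rightarrow> complex"
  shows
    "(\<forall>\<epsilon>. \<epsilon> \<noteq> 0 \<longrightarrow>
        (alpha_of \<epsilon> A 0 + alpha_of \<epsilon> A 1 + 2 * alpha_of \<epsilon> A 2 + 2 * alpha_of \<epsilon> A 3
          + 2 * alpha_of \<epsilon> A 4 + alpha_of \<epsilon> A 5 + alpha_of \<epsilon> A 6 = 1
         \<longleftrightarrow> A 0 + A 1 + A 2 + A 3 + A 4 = 1)) \<and>
     (A 0 + A 1 + A 2 + A 3 + A 4 = 1 \<longrightarrow>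
       (\<exists>K :: complex \<Rightarrow> hamiltonian.
          (\<forall>\<epsilon>. \<epsilon> \<noteq> 0 \<longrightarrow>
             holomorphic_hamiltonian (K \<epsilon>) \<and>
             (\<forall>D x y z w q p X Y Z W Q P.
                open D \<longrightarrow> 0 \<notin> D \<longrightarrow>
                (\<forall>T\<in>D. x (\<epsilon>^2 / 16 * T) = \<epsilon> / 4 * X T \<and> y (\<epsilon>^2 / 16 * T) = 2 * Y T / \<epsilon> \<and>
                       z (\<epsilon>^2 / 16 * T) = \<epsilon> / 4 * Z T \<and> w (\<epsilon>^2 / 16 * T) = 2 * W T / \<epsilon> \<and>
                       q (\<epsilon>^2 / 16 * T) = 4 * Q T / \<epsilon> \<and> p (\<epsilon>^2 / 16 * T) = \<epsilon> / 8 * P T) \<longrightarrow>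
                (ham_solution (ham_H (alpha_of \<epsilon> A)) ((\<lambda>T. \<epsilon>^2 / 16 * T) ` D) x y z w q p
                 \<longleftrightarrow> ham_solution (K \<epsilon>) D X Y Z W Q P))) \<and>
          (\<forall>T X Y Z W Q P. T \<noteq> 0 \<longrightarrow>
             ((\<lambda>\<epsilon>. ham_rhs (K \<epsilon>) T X Y Z W Q P)
                \<longlongrightarrow> ham_rhs (ham_limit A) T X Y Z W Q P) (at 0))))"
proof (intro conjI allI impI alpha_of_normalization_iff exI[of _ "rescaled_ham_H A"])
  fix \<epsilon> :: complex assume eps: "\<epsilon> \<noteq> 0"
  show "holomorphic_hamiltonian (rescaled_ham_H A \<epsilon>)"
    using eps unfolding rescaled_ham_H_def
    by (intro holomorphic_hamiltonian_rescale holomorphic_hamiltonian_ham_H) simp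
  fix D :: "complex set" and x y z w q p X Y Z W Q P :: "complex \<Rightarrow> complex"
  assume D: "open D" "0 \<notin> D"
    and sub: "\<forall>T\<in>D. x (\<epsilon>^2 / 16 * T) = \<epsilon> / 4 * X T \<and> y (\<epsilon>^2 / 16 * T) = 2 * Y T / \<epsilon> \<and>
                   z (\<epsilon>^2 / 16 * T) = \<epsilon> / 4 * Z T \<and> w (\<epsilon>^2 / 16 * T) = 2 * W T / \<epsilon> \<and>
                   q (\<epsilon>^2 / 16 * T) = 4 * Q T / \<epsilon> \<and> p (\<epsilon>^2 / 16 * T) = \<epsilon> / 8 * P T"
  show "ham_solution (ham_H (alpha_of \<epsilon> A)) ((\<lambda>T. \<epsilon>^2 / 16 * T) ` D) x y z w q p \<longleftrightarrow>
        ham_solution (rescaled_ham_H A \<epsilon>) D X Y Z W Q P"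
    unfolding rescaled_ham_H_def
    by (rule ham_solution_rescale[OF holomorphic_hamiltonian_ham_H])
       (use eps D sub in \<open>simp_all add: field_simps\<close>)
qed (rule tendsto_ham_rhs_rescaled_ham_H)

end
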